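(* Let $(Q,I)$ be a connected acyclic homogeneous bound quiver of finite global dimension, let $C_q$ be its $q$-Cartan matrix and $\Phi_q$ its $q$-Coxeter matrix (formed with any admissible numbering of $Q$). Then $$\Phi_q=-C_q^{T}C_q^{-1}.$$
   Context: Let $q$ be an indeterminate and $\Bbbk$ an algebraically closed field. A quiver is a finite directed graph $Q$ (multiple arrows allowed) with vertex set $Q_0=\{1,\dots,n\}$; it is acyclic if it has no oriented cycles. $\Bbbk Q$ is its path algebra (product of paths $p$ and $p'$ is the concatenation $pp'$ if the end of $p$ is the start of $p'$, and zero otherwise), graded by path length; $e_i$ is the trivial path at $i$. A homogeneous bound quiver is a pair $(Q,I)$, where $I$ is a set of linear combinations of paths, each combination involving paths of one common length (with the same start vertex and the same end vertex), such that the ideal $\langle I\rangle$ is admissible (contained in the square of the arrow ideal) and $A=\Bbbk Q/\langle I\rangle$ is finite-dimensional. Then $A$ is graded by path length. "Finite global dimension" means that $A$ has finite global dimension. $q$-Cartan matrix: $C_q=(c_{ij}(q))_{n\times n}$ with $c_{ij}(q)=\sum_{m}\dim_{\Bbbk}(e_iAe_j)_m\,q^m\in\mathbb{Z}[q]$, where $(e_iAe_j)_m$ is the degree-$m$ component of $e_iAe_j$ (spanned by classes of paths of length $m$ from $i$ to $j$). Under the finite global dimension hypothesis $C_q$ is invertible over $\mathbb{Z}[q]$. Put $A_q=C_q^{-1}+(C_q^{-1})^{T}=(a_{ij}(q))$, a symmetric matrix over $\mathbb{Z}[q]$, and $(\mathbf{x},\mathbf{y})_q=\tfrac12\mathbf{x}^{T}A_q\mathbf{y}$.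 With $\mathbf{e}_1,\dots,\mathbf{e}_n$ the canonical basis, the simple $q$-reflection is the $\mathbb{Z}[q]$-linear map $$\sigma_{i,q}(\mathbf{x})=\mathbf{x}-2(\mathbf{x},\mathbf{e}_i)_q\,\mathbf{e}_i$$ on $\mathbb{Z}[q]^n$, so $\sigma_{i,q}(\mathbf{e}_j)=\mathbf{e}_j-a_{ij}(q)\mathbf{e}_i$. Let $S_i$ be the matrix of $\sigma_{i,q}$ in the canonical basis (its $j$-th column is the coordinate vector of $\sigma_{i,q}(\mathbf{e}_j)$). Admissible numbering of $Q$: an ordering $(a_1,\dots,a_n)$ of $Q_0$ such that $a_1$ is a sink of $Q$ and, for each $k\ge 2$, $a_k$ is a sink of the full subquiver of $Q$ on $Q_0\setminus\{a_1,\dots,a_{k-1}\}$. $q$-Coxeter matrix of $(Q,I)$: $\Phi_q=S_{a_1}\cdots S_{a_{n-1}}S_{a_n}$ for an admissible numbering $(a_1,\dots,a_n)$ of $Q$. It does not depend on the admissible numbering chosen. *)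

theory Defs
  imports
    "HOL-Analysis.Analysis"
    "HOL-Library.Poly_Mapping"
    "HOL-Computational_Algebra.Polynomial"
    "HOL-Algebra.QuotRing"
    "HOL-Algebra.Ideal_Product"
    "HOL-Algebra.Module"
    "HOL-Algebra.Embedded_Algebras"
    "Graph_Theory.Graph_Theory"
begin

section \<open>Quivers and path algebras\<close>

text \<open>
  A quiver is a finite multidigraph in the sense of \<^locale>\<open>fin_digraph\<close>. A path is a triple
  (start, list of arrows, end); the end points are recorded so that the trivial paths
  \<open>e\<^sub>i = (i, [], i)\<close> are distinguished.
\<close>

type_synonym ('v, 'e) qpath = "'v \<times> 'e list \<times> 'v"

definition qpaths :: "('v, 'e) pre_digraph \<Rightarrow> ('v, 'e) qpath set" where
  "qpaths Q = {(u, p, v). pre_digraph.awalk Q u p v}"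

definition acyclic_quiver :: "('v, 'e) pre_digraph \<Rightarrow> bool" where
  "acyclic_quiver Q \<longleftrightarrow> \<not> (\<exists>p. pre_digraph.cycle Q p)"

fun path_length :: "('v, 'e) qpath \<Rightarrow> nat" where
  "path_length (u, p, v) = length p"

text \<open>The product of two paths with coefficient \<open>c\<close>, as an element of the path algebra.\<close>

fun path_prod :: "'k \<Rightarrow> ('v, 'e) qpath \<Rightarrow> ('v, 'e) qpath \<Rightarrow> (('v, 'e) qpath \<Rightarrow>\<^sub>0 'k::field)" where
  "path_prod c (u, p, v) (u', p', v') =
     (if v = u' then Poly_Mapping.single (u, p @ p', v') c else 0)"

definition path_idem :: "'v \<Rightarrow> (('v, 'e) qpath \<Rightarrow>\<^sub>0 'k::field)" where
  "path_idem i = Poly_Mapping.single (i, [], i) 1"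

text \<open>The scalar \<open>c\<close>, that is, \<open>c\<close> times the identity of the path algebra.\<close>

definition path_scalar :: "('v, 'e) pre_digraph \<Rightarrow> 'k::field \<Rightarrow> (('v, 'e) qpath \<Rightarrow>\<^sub>0 'k)" where
  "path_scalar Q c = (\<Sum>i\<in>verts Q. Poly_Mapping.single (i, [], i) c)"

definition path_algebra :: "('v, 'e) pre_digraph \<Rightarrow> (('v, 'e) qpath \<Rightarrow>\<^sub>0 'k::field) ring" where
  "path_algebra Q =
    \<lparr>carrier = {f. Poly_Mapping.keys f \<subseteq> qpaths Q},
     mult = (\<lambda>f g. \<Sum>x\<in>Poly_Mapping.keys f. \<Sum>y\<in>Poly_Mapping.keys g.
        path_prod (Poly_Mapping.lookup f x * Poly_Mapping.lookup g y) x y),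
     one = path_scalar Q 1,
     zero = 0,
     add = (+)\<rparr>"

definition path_arrow :: "('v, 'e) pre_digraph \<Rightarrow> 'e \<Rightarrow> (('v, 'e) qpath \<Rightarrow>\<^sub>0 'k::field)" where
  "path_arrow Q e = Poly_Mapping.single (tail Q e, [e], head Q e) 1"

definition arrow_ideal :: "('v, 'e) pre_digraph \<Rightarrow> (('v, 'e) qpath \<Rightarrow>\<^sub>0 'k::field) set" where
  "arrow_ideal Q = Idl\<^bsub>path_algebra Q\<^esub> (path_arrow Q ` arcs Q)"


section \<open>Homogeneous bound quivers\<close>

definition homogeneous_relation ::
    "('v, 'e) pre_digraph \<Rightarrow> (('v, 'e) qpath \<Rightarrow>\<^sub>0 'k::field) \<Rightarrow> bool" where
  "homogeneous_relation Q \<rho> \<longleftrightarrow>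
     (\<exists>u v m. Poly_Mapping.keys \<rho> \<subseteq> {(u, p, v) | p. (u, p, v) \<in> qpaths Q \<and> length p = m})"

definition relation_ideal ::
    "('v, 'e) pre_digraph \<Rightarrow> (('v, 'e) qpath \<Rightarrow>\<^sub>0 'k::field) set \<Rightarrow> (('v, 'e) qpath \<Rightarrow>\<^sub>0 'k) set" where
  "relation_ideal Q I = Idl\<^bsub>path_algebra Q\<^esub> I"

definition bound_quiver_algebra ::
    "('v, 'e) pre_digraph \<Rightarrow> (('v, 'e) qpath \<Rightarrow>\<^sub>0 'k::field) set \<Rightarrow> (('v, 'e) qpath \<Rightarrow>\<^sub>0 'k) set ring"
  where "bound_quiver_algebra Q I = path_algebra Q Quot relation_ideal Q I"

definition residue_class ::
    "('v, 'e) pre_digraph \<Rightarrow> (('v, 'e) qpath \<Rightarrow>\<^sub>0 'k::field) set \<Rightarrow> (('v, 'e) qpath \<Rightarrow>\<^sub>0 'k)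
      \<Rightarrow> (('v, 'e) qpath \<Rightarrow>\<^sub>0 'k) set"
  where "residue_class Q I f = relation_ideal Q I +>\<^bsub>path_algebra Q\<^esub> f"

text \<open>
  The copy of the ground field inside the algebra; dimensions over the ground field are the
  dimensions over this subfield in the sense of \<^theory>\<open>HOL-Algebra.Embedded_Algebras\<close>.
\<close>

definition ground_field ::
    "('v, 'e) pre_digraph \<Rightarrow> (('v, 'e) qpath \<Rightarrow>\<^sub>0 'k::field) set \<Rightarrow> (('v, 'e) qpath \<Rightarrow>\<^sub>0 'k) set set"
  where "ground_field Q I = range (\<lambda>c. residue_class Q I (path_scalar Q c))"

definition homogeneous_bound_quiver ::
    "('v, 'e) pre_digraph \<Rightarrow> (('v, 'e) qpath \<Rightarrow>\<^sub>0 'k::field) set \<Rightarrow> bool" where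
  "homogeneous_bound_quiver Q I \<longleftrightarrow>
     fin_digraph Q \<and>
     (\<forall>\<rho>\<in>I. homogeneous_relation Q \<rho>) \<and>
     relation_ideal Q I \<subseteq> ideal_prod (path_algebra Q) (arrow_ideal Q) (arrow_ideal Q) \<and>
     ring.finite_dimension (bound_quiver_algebra Q I) (ground_field Q I)
       (carrier (bound_quiver_algebra Q I))"


section \<open>Global dimension\<close>

text \<open>
  The locale \<^locale>\<open>Module.module\<close> requires a commutative ring; the axioms here are the same ones
  over an arbitrary ring.
\<close>

locale left_module = R?: ring R + M?: abelian_group M
  for R :: "('a, 'b) ring_scheme" (structure) and M :: "('a, 'm, 'c) module_scheme" (structure) +
  assumes smult_closed:
      "\<lbrakk>a \<in> carrier R; x \<in> carrier M\<rbrakk> \<Longrightarrow> a \<odot>\<^bsub>M\<^esub> x \<in> carrier M"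
    and smult_l_distr:
      "\<lbrakk>a \<in> carrier R; b \<in> carrier R; x \<in> carrier M\<rbrakk>
        \<Longrightarrow> (a \<oplus>\<^bsub>R\<^esub> b) \<odot>\<^bsub>M\<^esub> x = a \<odot>\<^bsub>M\<^esub> x \<oplus>\<^bsub>M\<^esub> b \<odot>\<^bsub>M\<^esub> x"
    and smult_r_distr:
      "\<lbrakk>a \<in> carrier R; x \<in> carrier M; y \<in> carrier M\<rbrakk>
        \<Longrightarrow> a \<odot>\<^bsub>M\<^esub> (x \<oplus>\<^bsub>M\<^esub> y) = a \<odot>\<^bsub>M\<^esub> x \<oplus>\<^bsub>M\<^esub> a \<odot>\<^bsub>M\<^esub> y"
    and smult_assoc:
      "\<lbrakk>a \<in> carrier R; b \<in> carrier R; x \<in> carrier M\<rbrakk>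
        \<Longrightarrow> (a \<otimes>\<^bsub>R\<^esub> b) \<odot>\<^bsub>M\<^esub> x = a \<odot>\<^bsub>M\<^esub> (b \<odot>\<^bsub>M\<^esub> x)"
    and smult_one: "x \<in> carrier M \<Longrightarrow> \<one>\<^bsub>R\<^esub> \<odot>\<^bsub>M\<^esub> x = x"

definition lmod_hom ::
    "('a, 'b) ring_scheme \<Rightarrow> ('a, 'm) module \<Rightarrow> ('a, 'n) module \<Rightarrow> ('m \<Rightarrow> 'n) set" where
  "lmod_hom R M N = {h \<in> carrier M \<rightarrow> carrier N.
     (\<forall>x\<in>carrier M. \<forall>y\<in>carrier M. h (x \<oplus>\<^bsub>M\<^esub> y) = h x \<oplus>\<^bsub>N\<^esub> h y) \<and>
     (\<forall>a\<in>carrier R. \<forall>x\<in>carrier M. h (a \<odot>\<^bsub>M\<^esub> x) = a \<odot>\<^bsub>N\<^esub> h x)}"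

definition finitely_generated_lmod :: "('a, 'b) ring_scheme \<Rightarrow> ('a, 'm) module \<Rightarrow> bool" where
  "finitely_generated_lmod R M \<longleftrightarrow> left_module R M \<and>
     (\<exists>S. finite S \<and> S \<subseteq> carrier M \<and> (\<forall>H. submodule H R M \<and> S \<subseteq> H \<longrightarrow> H = carrier M))"

text \<open>
  HOL cannot quantify over modules of all carrier types, so modules are taken with carrier in
  \<open>nat \<Rightarrow> 'a\<close>, where \<open>'a\<close> is the type of ring elements. That type contains the free modules
  \<open>R\<^sup>r\<close> (functions supported on \<open>{..<r}\<close>) and hence an isomorphic copy of every finitely
  generated module (on a set of coset representatives). So for finitely generated \<open>P\<close> the lifting
  property below, which can be tested on a surjection from some \<open>R\<^sup>r\<close> onto \<open>P\<close>, is the usual one.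
\<close>

definition projective_lmod :: "('a, 'b) ring_scheme \<Rightarrow> ('a, nat \<Rightarrow> 'a) module \<Rightarrow> bool" where
  "projective_lmod R P \<longleftrightarrow> left_module R P \<and>
     (\<forall>(N :: ('a, nat \<Rightarrow> 'a) module) (N' :: ('a, nat \<Rightarrow> 'a) module) g f.
        left_module R N \<and> left_module R N' \<and>
        g \<in> lmod_hom R N N' \<and> g ` carrier N = carrier N' \<and> f \<in> lmod_hom R P N'
        \<longrightarrow> (\<exists>h\<in>lmod_hom R P N. \<forall>x\<in>carrier P. g (h x) = f x))"

text \<open>
  Projective dimension at most \<open>d\<close>: there is an exact sequence
  \<open>0 \<rightarrow> L (d+1) \<rightarrow> \<dots> \<rightarrow> L 1 \<rightarrow> L 0 = M \<rightarrow> 0\<close> with \<open>L 1, \<dots>, L (d+1)\<close> finitely generated projective.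
\<close>

definition proj_dim_le :: "('a, 'b) ring_scheme \<Rightarrow> ('a, nat \<Rightarrow> 'a) module \<Rightarrow> nat \<Rightarrow> bool" where
  "proj_dim_le R M d \<longleftrightarrow>
     (\<exists>(L :: nat \<Rightarrow> ('a, nat \<Rightarrow> 'a) module) \<delta>.
        L 0 = M \<and>
        (\<forall>i\<in>{1..d + 1}. finitely_generated_lmod R (L i) \<and> projective_lmod R (L i)) \<and>
        (\<forall>i\<le>d. \<delta> i \<in> lmod_hom R (L (i + 1)) (L i)) \<and>
        \<delta> 0 ` carrier (L 1) = carrier (L 0) \<and>
        (\<forall>i<d. \<delta> (i + 1) ` carrier (L (i + 2)) = a_kernel (L (i + 1)) (L i) (\<delta> i)) \<and>
        a_kernel (L (d + 1)) (L d) (\<delta> d) = {\<zero>\<^bsub>L (d + 1)\<^esub>})"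

text \<open>
  The global dimension is the supremum of the projective dimensions of the finitely generated
  left modules. For the finite-dimensional algebras considered here, left and right modules, and
  resolutions by finitely generated or by arbitrary projectives, give the same number.
\<close>

definition finite_global_dimension :: "('a, 'b) ring_scheme \<Rightarrow> bool" where
  "finite_global_dimension R \<longleftrightarrow>
     (\<exists>d. \<forall>M :: ('a, nat \<Rightarrow> 'a) module. finitely_generated_lmod R M \<longrightarrow> proj_dim_le R M d)"


section \<open>The q-Cartan and q-Coxeter matrices\<close>

definition peirce_component ::
    "('v, 'e) pre_digraph \<Rightarrow> (('v, 'e) qpath \<Rightarrow>\<^sub>0 'k::field) set \<Rightarrow> 'v \<Rightarrow> 'v
      \<Rightarrow> (('v, 'e) qpath \<Rightarrow>\<^sub>0 'k) set set" where
  "peirce_component Q I i j =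
     (\<lambda>a. residue_class Q I (path_idem i) \<otimes>\<^bsub>bound_quiver_algebra Q I\<^esub> a
            \<otimes>\<^bsub>bound_quiver_algebra Q I\<^esub> residue_class Q I (path_idem j))
       ` carrier (bound_quiver_algebra Q I)"

definition degree_component ::
    "('v, 'e) pre_digraph \<Rightarrow> (('v, 'e) qpath \<Rightarrow>\<^sub>0 'k::field) set \<Rightarrow> nat
      \<Rightarrow> (('v, 'e) qpath \<Rightarrow>\<^sub>0 'k) set set" where
  "degree_component Q I m = residue_class Q I `
     {f \<in> carrier (path_algebra Q). \<forall>x\<in>Poly_Mapping.keys f. path_length x = m}"

text \<open>
  The sum over all \<open>m\<close> has only finitely many nonzero terms when the algebra is
  finite-dimensional, as \<^const>\<open>Sum_any\<close> requires. The variable of the polynomials is \<open>q\<close>.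
\<close>

definition q_cartan ::
    "('n::finite, 'e) pre_digraph \<Rightarrow> (('n, 'e) qpath \<Rightarrow>\<^sub>0 'k::field) set \<Rightarrow> int poly ^ 'n ^ 'n" where
  "q_cartan Q I = (\<chi> i j. Sum_any (\<lambda>m.
     Polynomial.monom (int (ring.dim (bound_quiver_algebra Q I) (ground_field Q I)
                   (peirce_component Q I i j \<inter> degree_component Q I m))) m))"

definition q_sym_matrix ::
    "('n::finite, 'e) pre_digraph \<Rightarrow> (('n, 'e) qpath \<Rightarrow>\<^sub>0 'k::field) set \<Rightarrow> int poly ^ 'n ^ 'n" where
  "q_sym_matrix Q I = matrix_inv (q_cartan Q I) + transpose (matrix_inv (q_cartan Q I))"

text \<open>
  Twice the symmetric bilinear form \<open>(x, y)\<^sub>q\<close>, so that the values stay in \<open>\<int>[q]\<close>; the factor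
  \<open>2\<close> in the formula for the reflections cancels the factor \<open>1/2\<close> of the form.
\<close>

definition q_form_twice ::
    "('n::finite, 'e) pre_digraph \<Rightarrow> (('n, 'e) qpath \<Rightarrow>\<^sub>0 'k::field) set
      \<Rightarrow> int poly ^ 'n \<Rightarrow> int poly ^ 'n \<Rightarrow> int poly" where
  "q_form_twice Q I x y = scalar_product x (q_sym_matrix Q I *v y)"

definition q_reflection ::
    "('n::finite, 'e) pre_digraph \<Rightarrow> (('n, 'e) qpath \<Rightarrow>\<^sub>0 'k::field) set
      \<Rightarrow> 'n \<Rightarrow> int poly ^ 'n \<Rightarrow> int poly ^ 'n" where
  "q_reflection Q I i x = x - q_form_twice Q I x (axis i 1) *s axis i 1"

definition admissible_numbering :: "('v, 'e) pre_digraph \<Rightarrow> 'v list \<Rightarrow> bool" where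
  "admissible_numbering Q as \<longleftrightarrow> distinct as \<and> set as = verts Q \<and>
     (\<forall>k<length as. out_arcs (induce_subgraph Q (verts Q - set (take k as))) (as ! k) = {})"

definition q_coxeter ::
    "('n::finite, 'e) pre_digraph \<Rightarrow> (('n, 'e) qpath \<Rightarrow>\<^sub>0 'k::field) set
      \<Rightarrow> 'n list \<Rightarrow> int poly ^ 'n ^ 'n" where
  "q_coxeter Q I as = foldr (**) (map (\<lambda>i. matrix (q_reflection Q I i)) as) (mat 1)"

end

theory Submission
  imports Defs
begin

text \<open>
  Write \<open>C\<close> for the \<open>q\<close>-Cartan matrix, \<open>B\<close> for its inverse and \<open>\<Phi>\<close> for the product of the simple
  reflections in the order of an admissible numbering. The identity comes from a triangular
  splitting of the symmetric form: its matrix \<open>B + B\<^sup>T\<close> is the sum of a unitriangular matrix and its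
  transpose, and one pass through the simple reflections is a Gauss-Seidel sweep for this
  splitting. Applied to a vector \<open>x\<close>, the reflections replace the coordinates one at a time, each
  new coordinate being computed from the old values of those still to be replaced and the new
  values of those already replaced. For \<open>y = \<Phi> x\<close> this says \<open>B\<^sup>T y = - B x\<close>
  (\<open>reflection_product_rows\<close>), and multiplying by \<open>C\<^sup>T\<close> gives \<open>\<Phi> = - C\<^sup>T B\<close>.

  The sweep needs \<open>B\<close> to be unitriangular along the numbering. In an admissible numbering every
  arrow goes from a later vertex to an earlier one (\<open>admissible_numbering_rank\<close>), so a nontrivial
  path from \<open>i\<close> to \<open>j\<close> exists only if \<open>j\<close> comes strictly before \<open>i\<close>. Off the diagonal this makes
  \<open>C\<close> triangular, because \<open>e\<^sub>i A e\<^sub>j = 0\<close> when no path leads from \<open>i\<close> to \<open>j\<close>. On the diagonal,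
  \<open>e\<^sub>i A e\<^sub>i\<close> is spanned by the class of \<open>e\<^sub>i\<close>. This class is nonzero and lies in degree \<open>0\<close> only,
  because the relations, lying in the square of the arrow ideal, do not involve trivial paths
  (\<open>relation_positive_length\<close>); hence \<open>C\<close> has diagonal entries \<open>1\<close>. The inverse of a unitriangular
  matrix exists over any commutative ring and is again unitriangular (\<open>unitriangular_inverse\<close>).

  The dimensions that define \<open>C\<close> are dimensions over a subfield of a ring, so they can be computed
  only once the path algebra is known to be a ring and the copy of the ground field in its
  quotient to be a subfield (\<open>path_algebra_ring\<close>, \<open>ground_field_subfield\<close>).
\<close>

section \<open>Linear algebra over a commutative ring\<close>

lemma matrix_add_rdistrib:
  fixes A B :: "'a::semiring_1 ^ 'm::finite ^ 'n" and X :: "'a ^ 'k ^ 'm"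
  shows "(A + B) ** X = A ** X + B ** X"
  by (simp add: vec_eq_iff matrix_matrix_mult_def distrib_right sum.distrib)

text \<open>
  The strictly triangular matrix \<open>N = 1 - C\<close> is nilpotent, since each factor \<open>N\<close> moves an index to
  one of smaller rank; so the Neumann series \<open>1 + N + N\<^sup>2 + \<dots>\<close> is a finite sum, which inverts \<open>C\<close>
  on both sides. Its terms are triangular, and only the term \<open>1\<close> meets the diagonal.
\<close>

lemma unitriangular_inverse:
  fixes C :: "'a::comm_ring_1 ^ 'n::finite ^ 'n" and r :: "'n \<Rightarrow> nat"
  assumes diag: "\<And>i. C $ i $ i = 1"
    and tri: "\<And>i j. i \<noteq> j \<Longrightarrow> \<not> r j < r i \<Longrightarrow> C $ i $ j = 0"
  obtains B where "C ** B = mat 1" "B ** C = mat 1" "\<And>i. B $ i $ i = 1"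
    and "\<And>i j. i \<noteq> j \<Longrightarrow> \<not> r j < r i \<Longrightarrow> B $ i $ j = 0"
proof -
  define N where "N = mat 1 - C"
  define P where "P k = ((**) N ^^ k) (mat 1)" for k
  have P0: "P 0 = mat 1" and PSuc: "P (Suc k) = N ** P k" for k
    by (simp_all add: P_def)
  have N0: "r j < r i" if "N $ i $ j \<noteq> 0" for i j
    using that diag tri by (cases "i = j") (auto simp: N_def mat_def)
  have low: "r j + k \<le> r i" if "P k $ i $ j \<noteq> 0" for k i j
    using that
  proof (induction k arbitrary: i)
    case 0
    then show ?case by (auto simp: P0 mat_def split: if_splits)
  next
    case (Suc k)
    from Suc.prems have "(\<Sum>l\<in>UNIV. N $ i $ l * P k $ l $ j) \<noteq> 0"
      by (simp add: PSuc matrix_matrix_mult_def)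
    then obtain l where "N $ i $ l * P k $ l $ j \<noteq> 0"
      by (meson sum.neutral)
    then have "N $ i $ l \<noteq> 0" "P k $ l $ j \<noteq> 0" by auto
    with N0 Suc.IH show ?case by fastforce
  qed
  \<comment> \<open>A nonzero entry of \<open>N\<^sup>n\<close> would need a drop of the rank by more than its maximum.\<close>
  define n where "n = Suc (Max (range r))"
  have "r i < n" for i
    by (simp add: n_def le_imp_less_Suc)
  then have "P n $ i $ j = 0" for i j
    using low[of n i j] by (metis add_leD2 leD)
  then have Pn: "P n = 0"
    by (simp add: vec_eq_iff)
  define B where "B = (\<Sum>k<n. P k)"
  have CN: "C + N = mat 1" by (simp add: N_def)
  have comm: "P k ** N = N ** P k" for k
    by (induction k) (simp_all add: P0 PSuc matrix_mul_assoc[symmetric])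
  have left: "C ** P k = P k - P (Suc k)" for k
    using matrix_add_rdistrib[of C N "P k"] CN by (simp add: algebra_simps PSuc)
  have right: "P k ** C = P k - P (Suc k)" for k
    using matrix_add_ldistrib[of "P k" C N] CN by (simp add: algebra_simps PSuc comm)
  have tel1: "C ** (\<Sum>k<m. P k) = mat 1 - P m" for m
    by (induction m) (simp_all add: P0 matrix_add_ldistrib left)
  have tel2: "(\<Sum>k<m. P k) ** C = mat 1 - P m" for m
    by (induction m) (simp_all add: P0 matrix_add_rdistrib right)
  have B_entry: "B $ i $ j = (\<Sum>k<n. P k $ i $ j)" for i j
    by (simp add: B_def sum_component)
  have n0: "0 \<in> {..<n}" by (simp add: n_def)
  show thesis
  proof (rule that[of B])
    show "C ** B = mat 1" "B ** C = mat 1"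
      using tel1[of n] tel2[of n] Pn by (simp_all add: B_def)
  next
    fix i
    have "P k $ i $ i = 0" if "k \<noteq> 0" for k
      using low[of k i i] that by fastforce
    then have "(\<Sum>k<n. P k $ i $ i) = P 0 $ i $ i"
      using n0 by (subst sum.remove[of _ 0]) (auto intro: sum.neutral)
    then show "B $ i $ i = 1"
      by (simp add: B_entry P0 mat_def)
  next
    fix i j assume ij: "i \<noteq> j" "\<not> r j < r i"
    have "P k $ i $ j = 0" for k
    proof (cases "k = 0")
      case True
      with ij show ?thesis by (simp add: P0 mat_def)
    next
      case False
      with ij low[of k i j] show ?thesis by fastforce
    qed
    then show "B $ i $ j = 0"
      by (simp add: B_entry)
  qed
qed

lemma matrix_inv_eqI:
  fixes C :: "'a::semiring_1 ^ 'n::finite ^ 'n"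
  assumes "C ** B = mat 1" "B ** C = mat 1"
  shows "matrix_inv C = B"
proof -
  have "C ** matrix_inv C = mat 1 \<and> matrix_inv C ** C = mat 1"
    unfolding matrix_inv_def by (rule someI[of _ B]) (simp add: assms)
  then have "matrix_inv C = matrix_inv C ** (C ** B)" "matrix_inv C ** C = mat 1"
    by (simp_all add: assms)
  then show ?thesis
    by (simp add: matrix_mul_assoc)
qed

text \<open>
  The reflection at the \<open>i\<close>-th basis vector for the symmetric form with matrix \<open>B + B\<^sup>T\<close>: it differs
  from the identity only in row \<open>i\<close>, from which row \<open>i\<close> of \<open>B + B\<^sup>T\<close> is subtracted.
\<close>

definition reflection_matrix :: "'a::comm_ring_1 ^ 'n ^ 'n \<Rightarrow> 'n \<Rightarrow> 'a ^ 'n ^ 'n" where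
  "reflection_matrix B i =
     (\<chi> a b. (if a = b then 1 else 0) - (if a = i then B $ i $ b + B $ b $ i else 0))"

lemma reflection_matrix_mult_entry:
  fixes B M :: "'a::comm_ring_1 ^ 'n::finite ^ 'n"
  shows "(reflection_matrix B i ** M) $ a $ b =
    M $ a $ b - (if a = i then (B ** M) $ i $ b + (transpose B ** M) $ i $ b else 0)"
proof -
  have "(reflection_matrix B i ** M) $ a $ b =
      (\<Sum>k\<in>UNIV. (if a = k then M $ k $ b else 0)
        - (if a = i then B $ i $ k * M $ k $ b + B $ k $ i * M $ k $ b else 0))"
    by (auto simp: matrix_matrix_mult_def reflection_matrix_def algebra_simps intro!: sum.cong)
  also have "\<dots> = M $ a $ b
      - (if a = i then (B ** M) $ i $ b + (transpose B ** M) $ i $ b else 0)"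
    by (auto simp: sum_subtractf sum.distrib matrix_matrix_mult_def transpose_def)
  finally show ?thesis .
qed

text \<open>
  The Gauss-Seidel sweep, as an induction that prepends a reflection. The rows outside \<open>zs\<close> are
  the coordinates not yet replaced. The reflection at \<open>i\<close> subtracts from row \<open>i\<close> of \<open>M\<close> the row
  \<open>D\<close> that is row \<open>i\<close> of \<open>B M + B\<^sup>T M\<close>, and this subtracts \<open>B\<^sub>i\<^sub>a D\<close> from row \<open>a\<close> of \<open>B\<^sup>T M\<close>. The rows
  with \<open>a\<close> in \<open>zs\<close> keep the value they have, as \<open>B\<^sub>i\<^sub>a = 0\<close>. Row \<open>i\<close> becomes minus row \<open>i\<close> of \<open>B M\<close>, as
  \<open>B\<^sub>i\<^sub>i = 1\<close>; and row \<open>i\<close> of \<open>B\<close> sees only rows of \<open>M\<close> that are still those of the identity.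
\<close>

lemma reflection_product_rows:
  fixes B :: "'a::comm_ring_1 ^ 'n::finite ^ 'n"
  assumes "sorted_wrt (\<lambda>i j. B $ i $ j = 0) zs" "distinct zs" "\<And>i. B $ i $ i = 1"
  defines "M \<equiv> foldr (**) (map (reflection_matrix B) zs) (mat 1)"
  shows "(\<forall>a. a \<notin> set zs \<longrightarrow> M $ a = mat 1 $ a) \<and>
         (\<forall>a\<in>set zs. (transpose B ** M) $ a = - B $ a)"
  using assms(1,2) unfolding M_def
proof (induction zs)
  case Nil
  then show ?case by simp
next
  case (Cons i zs)
  let ?M = "foldr (**) (map (reflection_matrix B) zs) (mat 1)"
  have rows: "?M $ a = mat 1 $ a" if "a \<notin> set zs" for a
    using Cons that by simp
  have replaced_rows: "(transpose B ** ?M) $ a = - B $ a" if "a \<in> set zs" for a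
    using Cons that by simp
  have i: "i \<notin> set zs" and B0: "\<And>j. j \<in> set zs \<Longrightarrow> B $ i $ j = 0"
    using Cons.prems by auto
  define D where "D b = (B ** ?M) $ i $ b + (transpose B ** ?M) $ i $ b" for b
  have entry: "(reflection_matrix B i ** ?M) $ a $ b = ?M $ a $ b - (if a = i then D b else 0)"
    for a b
    by (simp add: reflection_matrix_mult_entry D_def)
  have upd: "(transpose B ** (reflection_matrix B i ** ?M)) $ a $ b =
      (transpose B ** ?M) $ a $ b - B $ i $ a * D b" for a b
  proof -
    have "(transpose B ** (reflection_matrix B i ** ?M)) $ a $ b =
        (\<Sum>k\<in>UNIV. B $ k $ a * (reflection_matrix B i ** ?M) $ k $ b)"
      unfolding matrix_matrix_mult_def[of "transpose B"] by (simp add: transpose_def)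
    also have "\<dots> = (\<Sum>k\<in>UNIV. B $ k $ a * ?M $ k $ b - (if k = i then B $ i $ a * D b else 0))"
      by (intro sum.cong refl) (simp add: entry algebra_simps)
    also have "\<dots> = (transpose B ** ?M) $ a $ b - B $ i $ a * D b"
      by (simp add: sum_subtractf matrix_matrix_mult_def transpose_def)
    finally show ?thesis .
  qed
  have BM: "(B ** ?M) $ i $ b = B $ i $ b" for b
  proof -
    have "B $ i $ k * ?M $ k $ b = (if k = b then B $ i $ b else 0)" for k
      using B0[of k] rows[of k] by (cases "k \<in> set zs") (auto simp: mat_def)
    then show ?thesis
      by (simp add: matrix_matrix_mult_def)
  qed
  show ?case
  proof (intro conjI allI ballI impI)
    fix a assume "a \<notin> set (i # zs)"
    then show "foldr (**) (map (reflection_matrix B) (i # zs)) (mat 1) $ a = mat 1 $ a"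
      using rows[of a] by (simp add: vec_eq_iff[of "_ $ a"] entry)
  next
    fix a assume a: "a \<in> set (i # zs)"
    have "(transpose B ** (reflection_matrix B i ** ?M)) $ a $ b = - B $ a $ b" for b
    proof (cases "a = i")
      case True
      then show ?thesis
        by (simp add: upd assms(3) D_def BM)
    next
      case False
      with a show ?thesis
        by (simp add: upd B0 replaced_rows)
    qed
    then show "(transpose B ** foldr (**) (map (reflection_matrix B) (i # zs)) (mat 1)) $ a = - B $ a"
      by (simp add: vec_eq_iff[of "_ $ a"])
  qed
qed

lemma reflection_product_eq:
  fixes B C :: "'a::comm_ring_1 ^ 'n::finite ^ 'n"
  assumes "B ** C = mat 1" "\<And>i. B $ i $ i = 1"
    and "sorted_wrt (\<lambda>i j. B $ i $ j = 0) as" "distinct as" "set as = UNIV"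
  shows "foldr (**) (map (reflection_matrix B) as) (mat 1) = - (transpose C ** B)"
proof -
  let ?M = "foldr (**) (map (reflection_matrix B) as) (mat 1)"
  have "transpose B ** ?M = - B"
    using reflection_product_rows[OF assms(3,4,2)] assms(5) by (simp add: vec_eq_iff)
  moreover have "transpose C ** transpose B = mat 1"
    using assms(1) by (metis matrix_transpose_mul transpose_mat)
  ultimately have "?M = transpose C ** (- B)"
    by (metis matrix_mul_assoc matrix_mul_lid)
  also have "\<dots> = - (transpose C ** B)"
    by (simp add: vec_eq_iff matrix_matrix_mult_def sum_negf)
  finally show ?thesis .
qed

section \<open>Walks and admissible numberings\<close>

text \<open>
  The rank is the position in the numbering. A vertex \<open>a\<^sub>k\<close> is a sink once \<open>a\<^sub>1, \<dots>, a\<^sub>k\<^sub>-\<^sub>1\<close> are removed,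
  so an arrow that starts at \<open>a\<^sub>k\<close> must end at a removed vertex.
\<close>

lemma admissible_numbering_rank:
  assumes "wf_digraph Q" "admissible_numbering Q as"
  obtains r where "\<And>k. k < length as \<Longrightarrow> r (as ! k) = k"
    and "\<And>e. e \<in> arcs Q \<Longrightarrow> r (head Q e) < (r (tail Q e) :: nat)"
proof -
  define r where "r v = (THE k. k < length as \<and> as ! k = v)" for v
  have dist: "distinct as" and verts: "set as = verts Q"
    and sink: "\<And>k. k < length as \<Longrightarrow>
      out_arcs (induce_subgraph Q (verts Q - set (take k as))) (as ! k) = {}"
    using assms(2) by (auto simp: admissible_numbering_def)
  have r: "r (as ! k) = k" if "k < length as" for k
    unfolding r_def using that dist by (intro the_equality) (auto simp: nth_eq_iff_index_eq)
  have "r (head Q e) < r (tail Q e)" if e: "e \<in> arcs Q" for e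
  proof -
    have "tail Q e \<in> set as" "head Q e \<in> set as"
      using e assms(1) verts by (auto simp: wf_digraph_def)
    then obtain k l where k: "k < length as" "as ! k = tail Q e"
      and l: "l < length as" "as ! l = head Q e"
      by (auto simp: in_set_conv_nth)
    have "tail Q e \<notin> set (take k as)"
    proof
      assume "tail Q e \<in> set (take k as)"
      then obtain m where "m < k" "as ! m = tail Q e"
        by (auto simp: in_set_conv_nth)
      with k dist show False
        by (metis nat_neq_iff nth_eq_iff_index_eq order.strict_trans)
    qed
    moreover have "e \<notin> out_arcs (induce_subgraph Q (verts Q - set (take k as))) (as ! k)"
      using sink[OF k(1)] by simp
    ultimately have "head Q e \<in> set (take k as)"
      using e k(2) assms(1) by (auto simp: wf_digraph_def out_arcs_def induce_subgraph_def)
    then obtain m where "m < k" "as ! m = head Q e"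
      by (auto simp: in_set_conv_nth)
    then show ?thesis
      using r[OF k(1)] r[of m] k by simp
  qed
  with r show thesis by (rule that)
qed

lemma (in wf_digraph) awalk_rank_decreasing:
  assumes "\<And>e. e \<in> arcs G \<Longrightarrow> r (head G e) < (r (tail G e) :: nat)" "awalk u p v" "p \<noteq> []"
  shows "r v < r u"
  using assms(2,3)
proof (induction p arbitrary: u)
  case Nil
  then show ?case by simp
next
  case (Cons e p)
  then have "e \<in> arcs G" "tail G e = u" "awalk (head G e) p v"
    by (auto simp: awalk_Cons_iff)
  with assms(1)[of e] Cons.IH[of "head G e"] show ?case
    by (cases "p = []") (auto simp: awalk_Nil_iff)
qed

section \<open>The path algebra is a ring\<close>

text \<open>
  The product of the path algebra, on all finitely supported functions on triples: there it is
  already bilinear and associative, so these laws need no reference to a quiver.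
\<close>

definition path_mult ::
    "(('v, 'e) qpath \<Rightarrow>\<^sub>0 'k::field) \<Rightarrow> (('v, 'e) qpath \<Rightarrow>\<^sub>0 'k) \<Rightarrow> (('v, 'e) qpath \<Rightarrow>\<^sub>0 'k)" where
  "path_mult f g = (\<Sum>x\<in>Poly_Mapping.keys f. \<Sum>y\<in>Poly_Mapping.keys g.
     path_prod (Poly_Mapping.lookup f x * Poly_Mapping.lookup g y) x y)"

lemma path_algebra_sel [simp]:
  "carrier (path_algebra Q) = {f. Poly_Mapping.keys f \<subseteq> qpaths Q}"
  "f \<otimes>\<^bsub>path_algebra Q\<^esub> g = path_mult f g"
  "\<one>\<^bsub>path_algebra Q\<^esub> = path_scalar Q 1"
  "\<zero>\<^bsub>path_algebra Q\<^esub> = 0"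
  "f \<oplus>\<^bsub>path_algebra Q\<^esub> g = f + g"
  by (simp_all add: path_algebra_def path_mult_def)

lemma path_prod_zero [simp]: "path_prod 0 x y = 0"
  by (cases x; cases y) simp

lemma path_prod_add: "path_prod (c + d) x y = path_prod c x y + path_prod d x y"
  by (cases x; cases y) (simp add: single_add)

text \<open>
  Sums over a common finite set in place of the supports make additivity in each factor a
  termwise statement.
\<close>

lemma path_mult_superset:
  assumes "finite A" "Poly_Mapping.keys f \<subseteq> A" "finite B" "Poly_Mapping.keys g \<subseteq> B"
  shows "path_mult f g =
    (\<Sum>x\<in>A. \<Sum>y\<in>B. path_prod (Poly_Mapping.lookup f x * Poly_Mapping.lookup g y) x y)"
proof -
  have inner: "(\<Sum>y\<in>Poly_Mapping.keys g. path_prod (c * Poly_Mapping.lookup g y) x y) =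
      (\<Sum>y\<in>B. path_prod (c * Poly_Mapping.lookup g y) x y)" for c x
    using assms(3,4) by (intro sum.mono_neutral_left) (auto simp: in_keys_iff)
  show ?thesis
    unfolding path_mult_def inner
    using assms(1,2) by (intro sum.mono_neutral_left) (auto simp: in_keys_iff)
qed

lemma path_mult_add_left: "path_mult (f + f') g = path_mult f g + path_mult f' g"
proof -
  let ?A = "Poly_Mapping.keys f \<union> Poly_Mapping.keys f'"
  have "path_mult h g = (\<Sum>x\<in>?A. \<Sum>y\<in>Poly_Mapping.keys g.
      path_prod (Poly_Mapping.lookup h x * Poly_Mapping.lookup g y) x y)"
    if "Poly_Mapping.keys h \<subseteq> ?A" for h
    using that by (intro path_mult_superset) auto
  then show ?thesis
    using Poly_Mapping.keys_add[of f f']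
    by (simp add: lookup_add distrib_right path_prod_add sum.distrib)
qed

lemma path_mult_add_right: "path_mult f (g + g') = path_mult f g + path_mult f g'"
proof -
  let ?B = "Poly_Mapping.keys g \<union> Poly_Mapping.keys g'"
  have "path_mult f h = (\<Sum>x\<in>Poly_Mapping.keys f. \<Sum>y\<in>?B.
      path_prod (Poly_Mapping.lookup f x * Poly_Mapping.lookup h y) x y)"
    if "Poly_Mapping.keys h \<subseteq> ?B" for h
    using that by (intro path_mult_superset) auto
  then show ?thesis
    using Poly_Mapping.keys_add[of g g']
    by (simp add: lookup_add distrib_left path_prod_add sum.distrib)
qed

lemma path_mult_zero [simp]: "path_mult 0 g = 0" "path_mult f 0 = 0"
  by (simp_all add: path_mult_def)

lemma path_mult_sum_left: "path_mult (\<Sum>i\<in>A. f i) g = (\<Sum>i\<in>A. path_mult (f i) g)"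
  by (induction A rule: infinite_finite_induct) (simp_all add: path_mult_add_left)

lemma path_mult_sum_right: "path_mult f (\<Sum>i\<in>A. g i) = (\<Sum>i\<in>A. path_mult f (g i))"
  by (induction A rule: infinite_finite_induct) (simp_all add: path_mult_add_right)

lemma path_mult_single [simp]:
  "path_mult (Poly_Mapping.single x c) (Poly_Mapping.single y d) = path_prod (c * d) x y"
  by (subst path_mult_superset[of "{x}" _ "{y}"]) (auto split: if_splits)

lemma update_eq_add_single:
  assumes "a \<notin> Poly_Mapping.keys f"
  shows "Poly_Mapping.update a b f = Poly_Mapping.single a b + f"
  using assms
  by (intro poly_mapping_eqI) (auto simp: lookup_update lookup_add lookup_single in_keys_iff)

lemma poly_mapping_single_add_induct [case_names zero single_add]:
  assumes "P 0"
    and "\<And>f a b. a \<notin> Poly_Mapping.keys f \<Longrightarrow> P f \<Longrightarrow> P (Poly_Mapping.single a b + f)"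
  shows "P f"
  by (induction f rule: update_induct) (auto simp: update_eq_add_single intro: assms)

text \<open>By additivity in each factor it suffices to treat multiples of single paths.\<close>

lemma path_mult_assoc: "path_mult (path_mult f g) h = path_mult f (path_mult g h)"
proof (induction f rule: poly_mapping_single_add_induct)
  case (single_add f x c)
  have "path_mult (path_mult (Poly_Mapping.single x c) g) h =
      path_mult (Poly_Mapping.single x c) (path_mult g h)"
  proof (induction g rule: poly_mapping_single_add_induct)
    case (single_add g y d)
    have "path_mult (path_mult (Poly_Mapping.single x c) (Poly_Mapping.single y d)) h =
        path_mult (Poly_Mapping.single x c) (path_mult (Poly_Mapping.single y d) h)"
    proof (induction h rule: poly_mapping_single_add_induct)
      case (single_add h z e)
      have "path_mult (path_mult (Poly_Mapping.single x c) (Poly_Mapping.single y d))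
              (Poly_Mapping.single z e) =
            path_mult (Poly_Mapping.single x c)
              (path_mult (Poly_Mapping.single y d) (Poly_Mapping.single z e))"
        by (cases x; cases y; cases z) (simp add: mult.assoc)
      with single_add show ?case
        by (simp add: path_mult_add_right del: path_mult_single)
    qed simp
    with single_add show ?case
      by (simp add: path_mult_add_left path_mult_add_right del: path_mult_single)
  qed simp
  with single_add show ?case
    by (simp add: path_mult_add_left)
qed simp

lemma keys_path_mult:
  assumes "z \<in> Poly_Mapping.keys (path_mult f g)"
  obtains u p v q w where "z = (u, p @ q, w)"
    and "(u, p, v) \<in> Poly_Mapping.keys f" "(v, q, w) \<in> Poly_Mapping.keys g"
proof -
  obtain x where x: "x \<in> Poly_Mapping.keys f" and "z \<in> Poly_Mapping.keys
      (\<Sum>y\<in>Poly_Mapping.keys g. path_prod (Poly_Mapping.lookup f x * Poly_Mapping.lookup g y) x y)"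
    using assms keys_sum unfolding path_mult_def by (smt (verit) UN_E subsetD)
  then obtain y where y: "y \<in> Poly_Mapping.keys g"
    and z: "z \<in> Poly_Mapping.keys (path_prod (Poly_Mapping.lookup f x * Poly_Mapping.lookup g y) x y)"
    using keys_sum by (smt (verit) UN_E subsetD)
  obtain u p v where xx: "x = (u, p, v)" by (cases x)
  obtain v' q w where yy: "y = (v', q, w)" by (cases y)
  from z have "v = v'" "z = (u, p @ q, w)"
    by (auto simp: xx yy split: if_splits)
  with x y xx yy show thesis by (intro that[of u p q w v]) auto
qed

lemma path_scalar_mult_single:
  assumes "fin_digraph Q" "u \<in> verts Q" "v \<in> verts Q"
  shows "path_mult (path_scalar Q c) (Poly_Mapping.single (u, p, v) d) = Poly_Mapping.single (u, p, v) (c * d)"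
    and "path_mult (Poly_Mapping.single (u, p, v) d) (path_scalar Q c) = Poly_Mapping.single (u, p, v) (d * c)"
  using assms fin_digraph.finite_verts[OF assms(1)]
  by (simp_all add: path_scalar_def path_mult_sum_left path_mult_sum_right)

lemma qpathsD:
  assumes "wf_digraph Q" "(u, p, v) \<in> qpaths Q"
  shows "u \<in> verts Q" "v \<in> verts Q"
  using assms wf_digraph.awalk_hd_in_verts wf_digraph.awalk_last_in_verts
  by (fastforce simp: qpaths_def)+

lemma trivial_path_in_qpaths: "(i, [], j) \<in> qpaths Q \<longleftrightarrow> i = j \<and> i \<in> verts Q"
  by (auto simp: qpaths_def pre_digraph.awalk_def pre_digraph.cas.simps)

lemma path_scalar_one_mult:
  assumes "fin_digraph Q" "Poly_Mapping.keys f \<subseteq> qpaths Q"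
  shows "path_mult (path_scalar Q 1) f = f" "path_mult f (path_scalar Q 1) = f"
proof -
  have wf: "wf_digraph Q" using assms(1) by (simp add: fin_digraph_def)
  have "path_mult (path_scalar Q 1) f = f \<and> path_mult f (path_scalar Q 1) = f"
    using assms(2)
  proof (induction f rule: update_induct)
    case (update f a b)
    obtain u p v where a: "a = (u, p, v)" by (cases a)
    have "a \<in> qpaths Q" "Poly_Mapping.keys f \<subseteq> qpaths Q"
      using update by (auto simp: keys_update)
    with update.IH qpathsD[OF wf, of u p v] show ?case
      unfolding update_eq_add_single[OF update.hyps(1)]
      by (simp add: a path_mult_add_left path_mult_add_right
          path_scalar_mult_single[OF assms(1)])
  qed simp
  then show "path_mult (path_scalar Q 1) f = f" "path_mult f (path_scalar Q 1) = f"
    by simp_all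
qed

lemma keys_path_scalar:
  "Poly_Mapping.keys (path_scalar Q c) \<subseteq> {(i, [], i) | i. i \<in> verts Q}"
  unfolding path_scalar_def using keys_sum by (fastforce split: if_splits)

lemma path_scalar_in_carrier: "path_scalar Q c \<in> carrier (path_algebra Q)"
  using keys_path_scalar[of Q c] by (auto simp: trivial_path_in_qpaths)

lemma path_algebra_ring:
  assumes "fin_digraph Q"
  shows "ring (path_algebra Q :: (('v, 'e) qpath \<Rightarrow>\<^sub>0 'k::field) ring)"
proof -
  have wf: "wf_digraph Q" using assms by (simp add: fin_digraph_def)
  have closed: "Poly_Mapping.keys (path_mult f g) \<subseteq> qpaths Q"
    if "Poly_Mapping.keys f \<subseteq> qpaths Q" "Poly_Mapping.keys g \<subseteq> qpaths Q"
    for f g :: "('v, 'e) qpath \<Rightarrow>\<^sub>0 'k"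
  proof
    fix z assume "z \<in> Poly_Mapping.keys (path_mult f g)"
    then obtain u p v q w where "z = (u, p @ q, w)"
      "(u, p, v) \<in> Poly_Mapping.keys f" "(v, q, w) \<in> Poly_Mapping.keys g"
      by (rule keys_path_mult)
    then have "z = (u, p @ q, w)" "(u, p, v) \<in> qpaths Q" "(v, q, w) \<in> qpaths Q"
      using that by auto
    then show "z \<in> qpaths Q"
      using wf_digraph.awalk_appendI[OF wf, of u p v q w] by (simp add: qpaths_def)
  qed
  have one: "Poly_Mapping.keys (path_scalar Q 1 :: ('v, 'e) qpath \<Rightarrow>\<^sub>0 'k) \<subseteq> qpaths Q"
    using path_scalar_in_carrier[of Q 1] by simp
  have add: "Poly_Mapping.keys (f + g) \<subseteq> qpaths Q"
    if "Poly_Mapping.keys f \<subseteq> qpaths Q" "Poly_Mapping.keys g \<subseteq> qpaths Q"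
    for f g :: "('v, 'e) qpath \<Rightarrow>\<^sub>0 'k"
    using that Poly_Mapping.keys_add[of f g] by blast
  show ?thesis
  proof (rule ringI)
    show "abelian_group (path_algebra Q :: (('v, 'e) qpath \<Rightarrow>\<^sub>0 'k) ring)"
    proof (rule abelian_groupI)
      fix x :: "('v, 'e) qpath \<Rightarrow>\<^sub>0 'k"
      assume "x \<in> carrier (path_algebra Q)"
      then show "\<exists>y\<in>carrier (path_algebra Q). y \<oplus>\<^bsub>path_algebra Q\<^esub> x = \<zero>\<^bsub>path_algebra Q\<^esub>"
        by (intro bexI[of _ "- x"]) simp_all
    qed (simp_all add: add add_ac)
    show "Group.monoid (path_algebra Q :: (('v, 'e) qpath \<Rightarrow>\<^sub>0 'k) ring)"
      by (rule monoidI)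
        (simp_all add: closed one path_mult_assoc path_scalar_one_mult[OF assms])
  qed (simp_all add: path_mult_add_left path_mult_add_right)
qed

lemma path_scalar_mult_path_scalar:
  assumes "fin_digraph Q"
  shows "path_mult (path_scalar Q c) (path_scalar Q d) = path_scalar Q (c * d)"
proof -
  have "path_mult (path_scalar Q c) (path_scalar Q d) =
      (\<Sum>i\<in>verts Q. path_mult (path_scalar Q c) (Poly_Mapping.single (i, [], i) d))"
    by (simp add: path_scalar_def[of Q d] path_mult_sum_right)
  also have "\<dots> = path_scalar Q (c * d)"
    unfolding path_scalar_def[of Q "c * d"]
    by (intro sum.cong refl) (simp add: path_scalar_mult_single[OF assms])
  finally show ?thesis .
qed

lemma path_scalar_add: "path_scalar Q (c + d) = path_scalar Q c + path_scalar Q d"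
  by (simp add: path_scalar_def single_add sum.distrib)

text \<open>
  The type-class field as a record, so that the copy of the ground field in the algebra is the
  image of a field under a ring homomorphism.
\<close>

definition scalar_ring :: "'k::field ring" where
  "scalar_ring = \<lparr>carrier = UNIV, mult = (*), one = 1, zero = 0, add = (+)\<rparr>"

lemma scalar_ring_field: "field (scalar_ring :: 'k::field ring)"
proof -
  let ?k = "scalar_ring :: 'k ring"
  have "cring ?k"
  proof (rule cringI)
    show "abelian_group ?k"
      by (rule abelian_groupI) (auto simp: scalar_ring_def add_ac intro: exI[of _ "- _"])
    show "Group.comm_monoid ?k"
      by (rule comm_monoidI) (simp_all add: scalar_ring_def mult_ac)
  qed (simp_all add: scalar_ring_def distrib_right)
  then show ?thesis
    by (rule cring.cring_fieldI2)
      (auto simp: scalar_ring_def intro: exI[of _ "inverse _"] right_inverse)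
qed

lemma path_scalar_ring_hom:
  assumes "fin_digraph Q"
  shows "path_scalar Q \<in> ring_hom (scalar_ring :: 'k::field ring) (path_algebra Q)"
proof (rule ring_hom_memI)
  show "path_scalar Q c \<in> carrier (path_algebra Q)" for c :: 'k
    by (rule path_scalar_in_carrier)
qed (simp_all add: scalar_ring_def path_scalar_add path_scalar_mult_path_scalar[OF assms])

lemma keys_corner:
  fixes f :: "('v, 'e) qpath \<Rightarrow>\<^sub>0 'k::field"
  shows "Poly_Mapping.keys (path_mult (path_mult (path_idem i) f) (path_idem j))
     \<subseteq> {(i, p, j) | p. (i, p, j) \<in> Poly_Mapping.keys f}"
proof
  let ?e = "path_idem :: 'v \<Rightarrow> (('v, 'e) qpath \<Rightarrow>\<^sub>0 'k)"
  fix z assume "z \<in> Poly_Mapping.keys (path_mult (path_mult (?e i) f) (?e j))"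
  then obtain u p v q w where z: "z = (u, p @ q, w)"
    and l: "(u, p, v) \<in> Poly_Mapping.keys (path_mult (?e i) f)"
    and r: "(v, q, w) \<in> Poly_Mapping.keys (?e j)"
    by (rule keys_path_mult)
  from l obtain u' p' v' q' w' where up: "(u, p, v) = (u', p' @ q', w')"
    and l': "(u', p', v') \<in> Poly_Mapping.keys (?e i)" "(v', q', w') \<in> Poly_Mapping.keys f"
    by (rule keys_path_mult)
  from z up l' r show "z \<in> {(i, p, j) | p. (i, p, j) \<in> Poly_Mapping.keys f}"
    by (simp add: path_idem_def)
qed

text \<open>
  This ideal contains the arrows, hence the arrow ideal, hence all relations; this is how the
  trivial paths are kept out of the relations.
\<close>

lemma positive_length_ideal:
  assumes "fin_digraph Q"
  shows "ideal {f :: ('v, 'e) qpath \<Rightarrow>\<^sub>0 'k::field. Poly_Mapping.keys f \<subseteq> qpaths Q \<and>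
      (\<forall>x\<in>Poly_Mapping.keys f. path_length x \<noteq> 0)} (path_algebra Q)" (is "ideal ?J ?R")
proof -
  interpret ring ?R by (rule path_algebra_ring[OF assms])
  have minus: "\<ominus>\<^bsub>?R\<^esub> f = - f" if "Poly_Mapping.keys f \<subseteq> qpaths Q" for f :: "('v, 'e) qpath \<Rightarrow>\<^sub>0 'k"
    using that by (intro minus_equality) simp_all
  show ?thesis
  proof (rule idealI[OF ring_axioms])
    show "subgroup ?J (add_monoid ?R)"
    proof (rule add.subgroupI)
      show "?J \<noteq> {}" by (auto intro: exI[of _ 0])
      fix f g assume f: "f \<in> ?J" and "g \<in> ?J"
      then show "f \<oplus>\<^bsub>?R\<^esub> g \<in> ?J"
        using Poly_Mapping.keys_add[of f g] by (fastforce simp del: path_length.simps)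
      show "\<ominus>\<^bsub>?R\<^esub> f \<in> ?J"
        using f by (simp add: minus)
    qed auto
  next
    fix f g assume f: "f \<in> ?J" and g: "g \<in> carrier ?R"
    have "f \<in> carrier ?R" using f by simp
    then have "g \<otimes>\<^bsub>?R\<^esub> f \<in> carrier ?R" "f \<otimes>\<^bsub>?R\<^esub> g \<in> carrier ?R"
      using m_closed g by blast+
    then show "g \<otimes>\<^bsub>?R\<^esub> f \<in> ?J" "f \<otimes>\<^bsub>?R\<^esub> g \<in> ?J"
      using f by (auto elim!: keys_path_mult)
  qed
qed

section \<open>Peirce components of the bound quiver algebra\<close>

locale bound_quiver =
  fixes Q :: "('v, 'e) pre_digraph" and I :: "(('v, 'e) qpath \<Rightarrow>\<^sub>0 'k::field) set"
  assumes bound: "homogeneous_bound_quiver Q I"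
begin

lemma finite_quiver: "fin_digraph Q"
  using bound by (simp add: homogeneous_bound_quiver_def)

sublocale P: ring "path_algebra Q :: (('v, 'e) qpath \<Rightarrow>\<^sub>0 'k) ring"
  by (rule path_algebra_ring[OF finite_quiver])

sublocale rel: ideal "relation_ideal Q I" "path_algebra Q"
  unfolding relation_ideal_def
proof (rule P.genideal_ideal)
  show "I \<subseteq> carrier (path_algebra Q)"
    using bound by (fastforce simp: homogeneous_bound_quiver_def homogeneous_relation_def)
qed

sublocale A: ring "bound_quiver_algebra Q I"
  unfolding bound_quiver_algebra_def by (rule rel.quotient_is_ring)

lemma residue_hom: "residue_class Q I \<in> ring_hom (path_algebra Q) (bound_quiver_algebra Q I)"
  unfolding residue_class_def[abs_def] bound_quiver_algebra_def by (rule rel.rcos_ring_hom)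

lemma relation_positive_length:
  assumes "h \<in> relation_ideal Q I" "x \<in> Poly_Mapping.keys h"
  shows "path_length x \<noteq> 0"
proof -
  let ?J = "{f :: ('v, 'e) qpath \<Rightarrow>\<^sub>0 'k. Poly_Mapping.keys f \<subseteq> qpaths Q \<and>
      (\<forall>x\<in>Poly_Mapping.keys f. path_length x \<noteq> 0)}"
  have wf: "wf_digraph Q" using finite_quiver by (simp add: fin_digraph_def)
  have arrows: "path_arrow Q ` arcs Q \<subseteq> ?J"
    using wf_digraph.arc_implies_awalk[OF wf]
    by (auto simp: path_arrow_def qpaths_def split: if_splits)
  have sub: "arrow_ideal Q \<subseteq> ?J"
    unfolding arrow_ideal_def
    by (rule P.genideal_minimal[OF positive_length_ideal[OF finite_quiver] arrows])
  have "ideal (arrow_ideal Q) (path_algebra Q :: (('v, 'e) qpath \<Rightarrow>\<^sub>0 'k) ring)"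
    unfolding arrow_ideal_def using arrows by (intro P.genideal_ideal) auto
  then have "ideal_prod (path_algebra Q) (arrow_ideal Q) (arrow_ideal Q)
      \<subseteq> (arrow_ideal Q :: (('v, 'e) qpath \<Rightarrow>\<^sub>0 'k) set)"
    using P.ideal_prod_inter by blast
  then have "h \<in> ?J"
    using assms(1) sub bound by (auto simp: homogeneous_bound_quiver_def)
  with assms(2) show ?thesis by blast
qed

text \<open>
  Two representatives of a class differ by a relation, so the coefficient of a trivial path is a
  well-defined function on the bound quiver algebra.
\<close>

lemma residue_eqD:
  assumes "residue_class Q I f = residue_class Q I g"
    and "f \<in> carrier (path_algebra Q)" "g \<in> carrier (path_algebra Q)"
  shows "Poly_Mapping.lookup f (i, [], i) = Poly_Mapping.lookup g (i, [], i)"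
proof -
  have "f \<in> residue_class Q I g"
    using rel.a_rcos_self[OF assms(2)] assms(1) by (simp add: residue_class_def)
  then obtain h where h: "h \<in> relation_ideal Q I" "f = h + g"
    by (auto simp: residue_class_def a_r_coset_def')
  have "Poly_Mapping.lookup h (i, [], i) = 0"
    using relation_positive_length[OF h(1), of "(i, [], i)"] by (auto simp: in_keys_iff)
  with h(2) show ?thesis by (simp add: lookup_add)
qed

lemma single_trivial_in_carrier:
  "i \<in> verts Q \<Longrightarrow> Poly_Mapping.single (i, [], i) c \<in> carrier (path_algebra Q)"
  by (simp add: trivial_path_in_qpaths)

lemma residue_trivial_eq_zero_iff:
  assumes "i \<in> verts Q"
  shows "residue_class Q I (Poly_Mapping.single (i, [], i) c) = \<zero>\<^bsub>bound_quiver_algebra Q I\<^esub> \<longleftrightarrow> c = 0"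
proof -
  have zero: "residue_class Q I 0 = \<zero>\<^bsub>bound_quiver_algebra Q I\<^esub>"
    using ring_hom_zero[OF residue_hom P.ring_axioms A.ring_axioms] by simp
  have "c = 0" if "residue_class Q I (Poly_Mapping.single (i, [], i) c) = residue_class Q I 0"
    using residue_eqD[OF that single_trivial_in_carrier[OF assms], of i] by simp
  with zero show ?thesis by (metis single_zero)
qed

text \<open>
  A vertex is needed: the class of its trivial path is nonzero, which shows \<open>1 \<noteq> 0\<close> in the quotient.
\<close>

lemma ground_field_subfield:
  assumes "verts Q \<noteq> {}"
  shows "subfield (ground_field Q I) (bound_quiver_algebra Q I)"
proof -
  let ?k = "scalar_ring :: 'k ring"
  let ?h = "residue_class Q I \<circ> path_scalar Q"
  have k: "field ?k" by (rule scalar_ring_field)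
  have hom: "?h \<in> ring_hom ?k (bound_quiver_algebra Q I)"
    by (rule ring_hom_trans[OF path_scalar_ring_hom[OF finite_quiver] residue_hom])
  interpret h: ring_hom_ring ?k "bound_quiver_algebra Q I" ?h
    using k hom by (intro ring_hom_ringI2 A.ring_axioms) (auto simp: field_def domain_def cring_def)
  obtain i where i: "i \<in> verts Q" using assms by auto
  have "\<one>\<^bsub>bound_quiver_algebra Q I\<^esub> \<noteq> \<zero>\<^bsub>bound_quiver_algebra Q I\<^esub>"
  proof
    assume eq: "\<one>\<^bsub>bound_quiver_algebra Q I\<^esub> = \<zero>\<^bsub>bound_quiver_algebra Q I\<^esub>"
    let ?x = "residue_class Q I (Poly_Mapping.single (i, [], i) 1)"
    have "?x \<in> carrier (bound_quiver_algebra Q I)"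
      using ring_hom_closed[OF residue_hom single_trivial_in_carrier[OF i]] .
    then have "?x = \<zero>\<^bsub>bound_quiver_algebra Q I\<^esub>"
      using A.one_zeroD[OF eq] by blast
    then show False by (simp add: residue_trivial_eq_zero_iff[OF i])
  qed
  then have "subfield (?h ` carrier ?k) (bound_quiver_algebra Q I)"
    using h.img_is_subfield(2)[OF field.carrier_is_subfield[OF k]] by simp
  then show ?thesis
    by (simp add: ground_field_def scalar_ring_def image_comp)
qed

lemma peirce_component_eq:
  assumes "i \<in> verts Q" "j \<in> verts Q"
  shows "peirce_component Q I i j = residue_class Q I `
    (\<lambda>f. path_mult (path_mult (path_idem i) f) (path_idem j)) ` carrier (path_algebra Q)"
proof -
  have surj: "carrier (bound_quiver_algebra Q I) = residue_class Q I ` carrier (path_algebra Q)"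
    unfolding bound_quiver_algebra_def FactRing_def A_RCOSETS_def' residue_class_def[abs_def]
    by (simp add: UNION_singleton_eq_range del: path_algebra_sel)
  have idem: "path_idem l \<in> carrier (path_algebra Q)" if "l \<in> verts Q" for l
    using single_trivial_in_carrier[OF that, of 1] by (simp add: path_idem_def)
  have "residue_class Q I (path_idem i) \<otimes>\<^bsub>bound_quiver_algebra Q I\<^esub> residue_class Q I f
      \<otimes>\<^bsub>bound_quiver_algebra Q I\<^esub> residue_class Q I (path_idem j)
      = residue_class Q I (path_mult (path_mult (path_idem i) f) (path_idem j))"
    if f: "f \<in> carrier (path_algebra Q)" for f
    using ring_hom_mult[OF residue_hom P.m_closed[OF idem[OF assms(1)] f] idem[OF assms(2)]]
      ring_hom_mult[OF residue_hom idem[OF assms(1)] f] by simp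
  then show ?thesis
    unfolding peirce_component_def surj image_image by (intro image_cong refl)
qed

lemma peirce_component_no_walk:
  assumes "i \<in> verts Q" "j \<in> verts Q" "\<And>p. (i, p, j) \<notin> qpaths Q"
  shows "peirce_component Q I i j = {\<zero>\<^bsub>bound_quiver_algebra Q I\<^esub>}"
proof -
  have "path_mult (path_mult (path_idem i) f) (path_idem j) = 0"
    if "f \<in> carrier (path_algebra Q)" for f :: "('v, 'e) qpath \<Rightarrow>\<^sub>0 'k"
    using keys_corner[of i f j] that assms(3) by (fastforce simp flip: keys_eq_empty)
  then have "(\<lambda>f. path_mult (path_mult (path_idem i) f) (path_idem j)) ` carrier (path_algebra Q)
      = {0 :: ('v, 'e) qpath \<Rightarrow>\<^sub>0 'k}"
    using P.zero_closed by (auto simp del: path_algebra_sel(1))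
  then show ?thesis
    using ring_hom_zero[OF residue_hom P.ring_axioms A.ring_axioms]
    by (simp add: peirce_component_eq[OF assms(1,2)])
qed

lemma peirce_component_only_trivial:
  assumes "i \<in> verts Q" "\<And>p. (i, p, i) \<in> qpaths Q \<Longrightarrow> p = []"
  shows "peirce_component Q I i i =
    range (\<lambda>c. residue_class Q I (Poly_Mapping.single (i, [], i) c))"
proof -
  have "path_mult (path_mult (path_idem i) f) (path_idem i) \<in> range (Poly_Mapping.single (i, [], i))"
    if "f \<in> carrier (path_algebra Q)" for f :: "('v, 'e) qpath \<Rightarrow>\<^sub>0 'k"
  proof -
    let ?g = "path_mult (path_mult (path_idem i) f) (path_idem i)"
    have "Poly_Mapping.keys ?g \<subseteq> {(i, [], i)}"
      using keys_corner[of i f i] that assms(2) by fastforce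
    then have "?g = Poly_Mapping.single (i, [], i) (Poly_Mapping.lookup ?g (i, [], i))"
      by (intro poly_mapping_eqI) (auto simp: lookup_single when_def in_keys_iff)
    then show ?thesis by blast
  qed
  moreover have "Poly_Mapping.single (i, [], i) c \<in>
      (\<lambda>f. path_mult (path_mult (path_idem i) f) (path_idem i)) ` carrier (path_algebra Q)" for c :: 'k
    by (rule image_eqI[OF _ single_trivial_in_carrier[OF assms(1), of c]]) (simp add: path_idem_def)
  ultimately have "(\<lambda>f. path_mult (path_mult (path_idem i) f) (path_idem i)) ` carrier (path_algebra Q)
      = range (Poly_Mapping.single (i, [], i) :: 'k \<Rightarrow> _)"
    by blast
  then show ?thesis
    by (simp add: peirce_component_eq[OF assms(1) assms(1)] image_image)
qed

lemma zero_in_degree_component: "\<zero>\<^bsub>bound_quiver_algebra Q I\<^esub> \<in> degree_component Q I m"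
  unfolding degree_component_def
  using ring_hom_zero[OF residue_hom P.ring_axioms A.ring_axioms]
  by (intro image_eqI[of _ _ 0]) simp_all

lemma dim_zero:
  assumes "verts Q \<noteq> {}"
  shows "A.dim (ground_field Q I) {\<zero>\<^bsub>bound_quiver_algebra Q I\<^esub>} = 0"
  using A.dimI[OF ground_field_subfield[OF assms] A.zero_dim] by (simp add: over_def)

lemma dim_no_walk:
  assumes "i \<in> verts Q" "j \<in> verts Q" "\<And>p. (i, p, j) \<notin> qpaths Q"
  shows "A.dim (ground_field Q I) (peirce_component Q I i j \<inter> degree_component Q I m) = 0"
proof -
  have "peirce_component Q I i j \<inter> degree_component Q I m = {\<zero>\<^bsub>bound_quiver_algebra Q I\<^esub>}"
    using peirce_component_no_walk[OF assms] zero_in_degree_component[of m] by blast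
  moreover have "verts Q \<noteq> {}" using assms(1) by blast
  ultimately show ?thesis by (simp add: dim_zero)
qed

text \<open>
  Here \<open>e\<^sub>i A e\<^sub>i\<close> is the line spanned by the class of \<open>e\<^sub>i\<close>, which lies in degree \<open>0\<close>. A multiple
  \<open>c e\<^sub>i\<close> that is also a combination of paths of length \<open>m > 0\<close> modulo the relations has \<open>c = 0\<close>,
  by comparing coefficients of \<open>e\<^sub>i\<close>.
\<close>

lemma dim_only_trivial:
  assumes i: "i \<in> verts Q" and triv: "\<And>p. (i, p, i) \<in> qpaths Q \<Longrightarrow> p = []"
  shows "A.dim (ground_field Q I) (peirce_component Q I i i \<inter> degree_component Q I m) =
    (if m = 0 then 1 else 0)"
proof (cases "m = 0")
  case True
  let ?e = "residue_class Q I (Poly_Mapping.single (i, [], i) 1)"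
  have "residue_class Q I (Poly_Mapping.single (i, [], i) c) \<in> degree_component Q I m" for c
    unfolding degree_component_def
    using single_trivial_in_carrier[OF i, of c] True by (intro imageI) auto
  then have "peirce_component Q I i i \<subseteq> degree_component Q I m"
    by (auto simp: peirce_component_only_trivial[OF assms])
  then have int: "peirce_component Q I i i \<inter> degree_component Q I m = peirce_component Q I i i"
    by blast
  have e: "?e \<in> carrier (bound_quiver_algebra Q I)"
    using ring_hom_closed[OF residue_hom single_trivial_in_carrier[OF i]] .
  have scale: "residue_class Q I (path_scalar Q c) \<otimes>\<^bsub>bound_quiver_algebra Q I\<^esub> ?e =
      residue_class Q I (Poly_Mapping.single (i, [], i) c)" for c
    using ring_hom_mult[OF residue_hom path_scalar_in_carrier single_trivial_in_carrier[OF i], of c 1]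
    by (simp add: path_scalar_mult_single[OF finite_quiver i i])
  have "peirce_component Q I i i = A.line_extension (ground_field Q I) ?e {\<zero>\<^bsub>bound_quiver_algebra Q I\<^esub>}"
  proof (rule Set.set_eqI)
    fix u
    have "u \<in> A.line_extension (ground_field Q I) ?e {\<zero>\<^bsub>bound_quiver_algebra Q I\<^esub>} \<longleftrightarrow>
        (\<exists>c. u = residue_class Q I (Poly_Mapping.single (i, [], i) c))"
      using ring_hom_closed[OF residue_hom single_trivial_in_carrier[OF i]]
      by (simp add: A.line_extension_mem_iff ground_field_def scale)
    then show "u \<in> peirce_component Q I i i \<longleftrightarrow>
        u \<in> A.line_extension (ground_field Q I) ?e {\<zero>\<^bsub>bound_quiver_algebra Q I\<^esub>}"
      by (auto simp: peirce_component_only_trivial[OF assms])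
  qed
  moreover have "A.dimension (Suc 0) (ground_field Q I)
      (A.line_extension (ground_field Q I) ?e {\<zero>\<^bsub>bound_quiver_algebra Q I\<^esub>})"
    using e by (intro A.Suc_dim) (simp_all add: residue_trivial_eq_zero_iff[OF i])
  ultimately have "A.dimension 1 (ground_field Q I) (peirce_component Q I i i)" by simp
  moreover have "verts Q \<noteq> {}" using i by blast
  ultimately show ?thesis
    using A.dimI[OF ground_field_subfield] True int by (simp add: over_def)
next
  case False
  have "x = \<zero>\<^bsub>bound_quiver_algebra Q I\<^esub>"
    if x: "x \<in> peirce_component Q I i i" "x \<in> degree_component Q I m" for x
  proof -
    obtain c where c: "x = residue_class Q I (Poly_Mapping.single (i, [], i) c)"
      using x(1) by (auto simp: peirce_component_only_trivial[OF assms])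
    obtain g where g: "x = residue_class Q I g" "g \<in> carrier (path_algebra Q)"
      and len: "\<forall>y\<in>Poly_Mapping.keys g. path_length y = m"
      using x(2) by (auto simp: degree_component_def)
    have "Poly_Mapping.lookup g (i, [], i) = 0"
      using len False by (metis in_keys_iff list.size(3) path_length.simps)
    then have "c = 0"
      using residue_eqD[OF _ single_trivial_in_carrier[OF i] g(2), of c i] c g(1) by simp
    then show ?thesis using c residue_trivial_eq_zero_iff[OF i] by blast
  qed
  moreover have "\<zero>\<^bsub>bound_quiver_algebra Q I\<^esub> \<in> peirce_component Q I i i"
  proof -
    have "residue_class Q I (Poly_Mapping.single (i, [], i) 0) \<in> peirce_component Q I i i"
      by (auto simp only: peirce_component_only_trivial[OF assms])
    moreover have "residue_class Q I (Poly_Mapping.single (i, [], i) 0) =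
        \<zero>\<^bsub>bound_quiver_algebra Q I\<^esub>"
      by (simp only: residue_trivial_eq_zero_iff[OF i])
    ultimately show ?thesis by (simp only:)
  qed
  ultimately have "peirce_component Q I i i \<inter> degree_component Q I m = {\<zero>\<^bsub>bound_quiver_algebra Q I\<^esub>}"
    using zero_in_degree_component by blast
  moreover have "verts Q \<noteq> {}" using i by blast
  ultimately show ?thesis using False by (simp add: dim_zero)
qed

end

section \<open>The q-Coxeter matrix\<close>

lemma q_cartan_unitriangular:
  fixes Q :: "('n::finite, 'e) pre_digraph" and I :: "(('n, 'e) qpath \<Rightarrow>\<^sub>0 'k::field) set"
  assumes "verts Q = UNIV" "homogeneous_bound_quiver Q I"
    and rank: "\<And>e. e \<in> arcs Q \<Longrightarrow> r (head Q e) < (r (tail Q e) :: nat)"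
  shows "q_cartan Q I $ i $ i = 1"
    and "i \<noteq> j \<Longrightarrow> \<not> r j < r i \<Longrightarrow> q_cartan Q I $ i $ j = 0"
proof -
  interpret bound_quiver Q I by standard (rule assms(2))
  interpret fin_digraph Q by (rule finite_quiver)
  have walk: "p = [] \<or> r v < r u" if "(u, p, v) \<in> qpaths Q" for u p v
    using awalk_rank_decreasing[OF rank] that by (auto simp: qpaths_def)
  have "Polynomial.monom (int (A.dim (ground_field Q I)
      (peirce_component Q I i i \<inter> degree_component Q I m))) m = (1 when m = 0)" for m
    using walk[of i _ i] by (subst dim_only_trivial) (auto simp: assms(1))
  then show "q_cartan Q I $ i $ i = 1"
    by (simp add: q_cartan_def)
  assume "i \<noteq> j" "\<not> r j < r i"
  then have "(i, p, j) \<notin> qpaths Q" for p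
    using walk[of i p j] by (auto simp: trivial_path_in_qpaths)
  then show "q_cartan Q I $ i $ j = 0"
    by (simp add: q_cartan_def dim_no_walk assms(1))
qed

lemma matrix_q_reflection:
  "matrix (q_reflection Q I i) = reflection_matrix (matrix_inv (q_cartan Q I)) i"
proof -
  let ?B = "matrix_inv (q_cartan Q I)"
  have "q_form_twice Q I (axis b 1) (axis i 1) = ?B $ i $ b + ?B $ b $ i" for b
    by (simp add: q_form_twice_def q_sym_matrix_def scalar_product_def matrix_vector_mult_def
        axis_def transpose_def if_distrib if_distribR cong: if_cong)
  then show ?thesis
    by (simp add: vec_eq_iff matrix_def reflection_matrix_def q_reflection_def axis_def)
qed

theorem theorem6p4:
  fixes Q :: "('n::finite, 'e) pre_digraph"
    and I :: "(('n, 'e) qpath \<Rightarrow>\<^sub>0 'k::alg_closed_field) set"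
    and as :: "'n list"
  assumes "verts Q = UNIV"
    and "homogeneous_bound_quiver Q I"
    and "Digraph_Component.connected Q"
    and "acyclic_quiver Q"
    and "finite_global_dimension (bound_quiver_algebra Q I)"
    and "admissible_numbering Q as"
  shows "q_coxeter Q I as = - (transpose (q_cartan Q I) ** matrix_inv (q_cartan Q I))"
proof -
  let ?C = "q_cartan Q I"
  have wf: "wf_digraph Q"
    using assms(2) by (simp add: homogeneous_bound_quiver_def fin_digraph_def)
  obtain r where idx: "\<And>k. k < length as \<Longrightarrow> r (as ! k) = k"
    and rank: "\<And>e. e \<in> arcs Q \<Longrightarrow> r (head Q e) < (r (tail Q e) :: nat)"
    by (rule admissible_numbering_rank[OF wf assms(6)]) blast
  note C = q_cartan_unitriangular[OF assms(1,2) rank]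
  obtain B where B: "?C ** B = mat 1" "B ** ?C = mat 1" "\<And>i. B $ i $ i = 1"
    and tri: "\<And>i j. i \<noteq> j \<Longrightarrow> \<not> r j < r i \<Longrightarrow> B $ i $ j = 0"
    using unitriangular_inverse[of ?C r] C by blast
  have inv: "matrix_inv ?C = B"
    by (rule matrix_inv_eqI[OF B(1,2)])
  have as: "distinct as" "set as = UNIV"
    using assms(1,6) by (auto simp: admissible_numbering_def)
  have "B $ (as ! k) $ (as ! l) = 0" if "k < l" "l < length as" for k l
    using that idx[of k] idx[of l] by (intro tri) auto
  then have "sorted_wrt (\<lambda>i j. B $ i $ j = 0) as"
    by (auto simp: sorted_wrt_iff_nth_less)
  then have "foldr (**) (map (reflection_matrix B) as) (mat 1) = - (transpose ?C ** B)"
    using reflection_product_eq[OF B(2,3)] as by blast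
  then show ?thesis
    by (simp add: q_coxeter_def matrix_q_reflection inv)
qed

end
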